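(* Let $K=\{x=(x_1,x_2)\in\mathbb{R}^2 : x_1\ge 0,\ x_2\ge 0\}$, let $K_1=\{x\in K : x_1>2x_2\}$, $K_3=\{x\in K : x_2>2x_1\}$, and $K_2=K\setminus(K_1\cup K_3)$. Define $T\colon K\to K$ by $$T(x)=\begin{cases}\begin{pmatrix}2&2\\1&1\end{pmatrix}x & \text{if } x\in K_1,\\[6pt] 3x & \text{if } x\in K_2,\\[6pt] \begin{pmatrix}1&1\\2&2\end{pmatrix}x & \text{if } x\in K_3.\end{cases}$$ Then $T$ is continuous, 1-homogeneous, strongly positive and strictly order-preserving, and every nonzero element of $K_2$ is an eigenvector of $T$ (with eigenvalue $3$). In particular, $T$ has multiple unit eigenvectors in $K$.
   Context: For $x,y\in\mathbb{R}^2$ write $x\preceq y$ if $y-x\in K$, and $x\prec y$ if $x\preceq y$ and $x\neq y$. Let $\mathring{K}$ denote the interior of $K$ in $\mathbb{R}^2$. A map $T\colon K\to K$ is: 1-homogeneous if $T(tx)=tT(x)$ for all $t\ge 0$ and $x\in K$; strongly positive if $T(K\setminus\{0\})\subset\mathring{K}$; strictly order-preserving if, for $x,y\in K$, $x\prec y$ implies $T(x)\prec T(y)$. An eigenvector of $T$ in $K$ is a nonzero $x\in K$ with $T(x)=\lambda x$ for some $\lambda\in\mathbb{R}$; it is a unit eigenvector if $\|x\|=1$, with $\|\cdot\|$ the norm on $\mathbb{R}^2$. *)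

theory Defs
  imports "HOL-Analysis.Analysis"
begin

definition K :: "(real^2) set" where
  "K = {x. x $ 1 \<ge> 0 \<and> x $ 2 \<ge> 0}"

definition K1 :: "(real^2) set" where
  "K1 = {x \<in> K. x $ 1 > 2 * x $ 2}"

definition K3 :: "(real^2) set" where
  "K3 = {x \<in> K. x $ 2 > 2 * x $ 1}"

definition K2 :: "(real^2) set" where
  "K2 = K - (K1 \<union> K3)"

definition cone_le :: "real^2 \<Rightarrow> real^2 \<Rightarrow> bool" (infix "\<preceq>" 50) where
  "x \<preceq> y \<longleftrightarrow> y - x \<in> K"

definition cone_less :: "real^2 \<Rightarrow> real^2 \<Rightarrow> bool" (infix "\<prec>" 50) where
  "x \<prec> y \<longleftrightarrow> x \<preceq> y \<and> x \<noteq> y"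

text \<open>Self-maps of the cone are represented by total functions on the plane; every notion
  below depends only on the values on the cone.\<close>

definition one_homogeneous :: "(real^2 \<Rightarrow> real^2) \<Rightarrow> bool" where
  "one_homogeneous F \<longleftrightarrow> (\<forall>t\<ge>0. \<forall>x\<in>K. F (t *\<^sub>R x) = t *\<^sub>R F x)"

definition strongly_positive :: "(real^2 \<Rightarrow> real^2) \<Rightarrow> bool" where
  "strongly_positive F \<longleftrightarrow> F ` (K - {0}) \<subseteq> interior K"

definition strictly_order_preserving :: "(real^2 \<Rightarrow> real^2) \<Rightarrow> bool" where
  "strictly_order_preserving F \<longleftrightarrow> (\<forall>x\<in>K. \<forall>y\<in>K. x \<prec> y \<longrightarrow> F x \<prec> F y)"

definition eigenvector_in_K :: "(real^2 \<Rightarrow> real^2) \<Rightarrow> real^2 \<Rightarrow> bool" where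
  "eigenvector_in_K F x \<longleftrightarrow> x \<in> K \<and> x \<noteq> 0 \<and> (\<exists>l::real. F x = l *\<^sub>R x)"

definition unit_eigenvector_in_K :: "(real^2 \<Rightarrow> real^2) \<Rightarrow> real^2 \<Rightarrow> bool" where
  "unit_eigenvector_in_K F x \<longleftrightarrow> eigenvector_in_K F x \<and> norm x = 1"

definition T :: "real^2 \<Rightarrow> real^2" where
  "T x =
    (if x \<in> K1 then (vector [vector [2, 2], vector [1, 1]] :: real^2^2) *v x
     else if x \<in> K2 then 3 *\<^sub>R x
     else if x \<in> K3 then (vector [vector [1, 1], vector [2, 2]] :: real^2^2) *v x
     else undefined)"

end

theory Submission imports Defs begin

text \<open>With \<open>s = x\<^sub>1 + x\<^sub>2\<close>, the three branches glue to the single formula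
  \<open>T\<^sub>i(x) = max s (min (3 x\<^sub>i) (2 s))\<close> on the cone. Each coordinate is thus continuous, homogeneous,
  positive off \<open>0\<close> and monotone; strictness follows since \<open>T\<^sub>1(x) + T\<^sub>2(x) = 3 s\<close>.\<close>

lemma T_component_on_K:
  assumes "x \<in> K"
  shows "T x $ i = max (x $ 1 + x $ 2) (min (3 * x $ i) (2 * (x $ 1 + x $ 2)))"
proof -
  have "i = 1 \<or> i = 2"
    using exhaust_2 by blast
  \<comment> \<open>With \<open>s = x $ 1 + x $ 2\<close>, the condition
    \<open>x $ 1 > 2 * x $ 2\<close> is equivalent both to \<open>3 * x $ 1 > 2 * s\<close> and to
    \<open>3 * x $ 2 < s\<close>. So on \<open>K1\<close> one coordinate is cut off above and the
    other below; \<open>K3\<close> is the mirror case, and on \<open>K2\<close> no cut-off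
    acts.\<close>
  then show ?thesis
    using assms
    by (auto simp: T_def K_def K1_def K2_def K3_def matrix_vector_mult_def sum_2 max_def min_def)
qed

text \<open>The values \<open>3 * x $ 1\<close> and \<open>3 * x $ 2\<close> are mirror images about
  the midpoint of the interval from \<open>s\<close> to \<open>2 * s\<close>, and truncation to that
  interval keeps this symmetry.\<close>

lemma T_component_sum_on_K:
  assumes "x \<in> K"
  shows "T x $ 1 + T x $ 2 = 3 * (x $ 1 + x $ 2)"
  using assms unfolding T_component_on_K[OF assms] K_def by (simp add: max_def min_def)

lemma interior_K_superset: "{x. x $ 1 > 0 \<and> x $ 2 > 0} \<subseteq> interior K"
  by (intro interior_maximal) (auto simp: K_def intro!: open_Collect_conj open_Collect_less continuous_intros)

lemma T_maps_K: "T \<in> K \<rightarrow> K"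
proof
  fix x assume x: "x \<in> K"
  then have "x $ 1 + x $ 2 \<ge> 0"
    by (simp add: K_def)
  with x show "T x \<in> K"
    by (subst K_def) (simp add: T_component_on_K le_max_iff_disj)
qed

lemma continuous_on_T: "continuous_on K T"
proof (subst continuous_on_componentwise, intro ballI)
  fix b :: "real^2" assume "b \<in> Basis"
  then obtain i where b: "b = axis i 1"
    by (auto simp: Basis_vec_def)
  have "continuous_on K (\<lambda>x::real^2. max (x $ 1 + x $ 2) (min (3 * x $ i) (2 * (x $ 1 + x $ 2))))"
    by (intro continuous_intros)
  then have "continuous_on K (\<lambda>x. T x $ i)"
    by (rule continuous_on_eq) (simp add: T_component_on_K)
  then show "continuous_on K (\<lambda>x. T x \<bullet> b)"
    by (simp add: b inner_axis)
qed

lemma one_homogeneous_T: "one_homogeneous T"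
  unfolding one_homogeneous_def
proof (intro allI impI ballI)
  fix t :: real and x assume t: "t \<ge> 0" and x: "x \<in> K"
  then have tx: "t *\<^sub>R x \<in> K"
    by (simp add: K_def)
  \<comment> \<open>A factor \<open>t \<ge> 0\<close> passes through \<open>max\<close> and
    \<open>min\<close>; a negative one would swap them.\<close>
  show "T (t *\<^sub>R x) = t *\<^sub>R T x"
    using t by (simp add: vec_eq_iff T_component_on_K[OF x] T_component_on_K[OF tx]
        max_mult_distrib_left min_mult_distrib_left algebra_simps)
qed

text \<open>The lower cut-off \<open>x $ 1 + x $ 2\<close> is positive off the origin, so even the
  boundary rays of the cone are mapped inside.\<close>

lemma strongly_positive_T: "strongly_positive T"
  unfolding strongly_positive_def
proof (intro image_subsetI)
  fix x assume x: "x \<in> K - {0}"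
  then have "x $ 1 + x $ 2 > 0"
    by (auto simp: K_def vec_eq_iff forall_2)
  with x show "T x \<in> interior K"
    by (intro subsetD[OF interior_K_superset]) (simp add: T_component_on_K less_max_iff_disj)
qed

lemma strictly_order_preserving_T: "strictly_order_preserving T"
  unfolding strictly_order_preserving_def
proof (intro ballI impI)
  fix x y assume x: "x \<in> K" and y: "y \<in> K" and "cone_less x y"
  then have le: "x $ 1 \<le> y $ 1" "x $ 2 \<le> y $ 2"
    and less: "x $ 1 + x $ 2 < y $ 1 + y $ 2"
    by (auto simp: cone_less_def cone_le_def K_def vec_eq_iff forall_2)
  \<comment> \<open>Both cut-offs and the truncated value grow with the argument.\<close>
  have "T x $ i \<le> T y $ i" for i
    using le less exhaust_2[of i] unfolding T_component_on_K[OF x] T_component_on_K[OF y]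
    by (intro max.mono min.mono) auto
  moreover have "T x \<noteq> T y"
    using T_component_sum_on_K[OF x] T_component_sum_on_K[OF y] less by auto
  ultimately show "cone_less (T x) (T y)"
    by (simp add: cone_less_def cone_le_def K_def)
qed

lemma eigenvector_T_K2:
  assumes "x \<in> K2 - {0}"
  shows "eigenvector_in_K T x \<and> T x = 3 *\<^sub>R x"
  using assms by (auto simp: eigenvector_in_K_def T_def K2_def)

lemma two_unit_eigenvectors_T:
  "\<exists>x y. unit_eigenvector_in_K T x \<and> unit_eigenvector_in_K T y \<and> x \<noteq> y"
proof -
  \<comment> \<open>The 3-4-5 triangle gives rational unit vectors; their coordinate ratio 4/3 is
    below 2, which puts them in \<open>K2\<close>.\<close>
  define x y :: "real^2" where "x = vector [3/5, 4/5]" and "y = vector [4/5, 3/5]"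
  have "x \<in> K2 - {0}" "y \<in> K2 - {0}" "x \<noteq> y"
    by (auto simp: x_def y_def K_def K1_def K2_def K3_def vec_eq_iff forall_2)
  moreover have "norm x = 1" "norm y = 1"
    by (simp_all add: x_def y_def norm_vec_def L2_set_def sum_2 power2_eq_square)
  ultimately show ?thesis
    using eigenvector_T_K2 unfolding unit_eigenvector_in_K_def by blast
qed

theorem mainTheorem1:
  "T \<in> K \<rightarrow> K \<and>
   continuous_on K T \<and>
   one_homogeneous T \<and>
   strongly_positive T \<and>
   strictly_order_preserving T \<and>
   (\<forall>x\<in>K2 - {0}. eigenvector_in_K T x \<and> T x = 3 *\<^sub>R x) \<and>
   (\<exists>x y. unit_eigenvector_in_K T x \<and> unit_eigenvector_in_K T y \<and> x \<noteq> y)"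
  using T_maps_K continuous_on_T one_homogeneous_T strongly_positive_T
    strictly_order_preserving_T eigenvector_T_K2 two_unit_eigenvectors_T
  by blast

end
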